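(* Let $X$ be a real Banach space, let $Y$ be a real non-reflexive Banach space, and let $Z \subset Y$ be a closed subspace of finite codimension such that there is a contractive linear projection $P: Y \rightarrow Y$ (that is, $P$ is linear, $P^2 = P$ and $\|P\| \le 1$) with $\ker(P) = Z$. Let $T \in \mathcal{L}(X,Y)$ be such that $T \perp \mathcal{L}(X,Z)$. Then there is an extreme point $\Lambda$ of $X^{\ast\ast}_1$ such that $$\|T\| = \|T^{\ast\ast}\| = \|T^{\ast\ast}(\Lambda)\| \quad \text{and} \quad T^{\ast\ast}(\Lambda) \perp Z^{\bot\bot}.$$
   Context: $\mathcal{L}(X,Y)$ denotes the space of bounded linear operators from $X$ to $Y$ with the operator norm; for a closed subspace $Z \subset Y$, $\mathcal{L}(X,Z)$ is regarded as a subspace of $\mathcal{L}(X,Y)$. For a Banach space $W$, $W_1$ denotes its closed unit ball; $X^{\ast\ast}_1$ is the closed unit ball of the bidual $X^{\ast\ast}$. For a vector $w$ in a Banach space $W$ and a subspace $V \subset W$, $w \perp V$ (Birkhoff-James orthogonality) means $\|w+v\| \ge \|w\|$ for all $v \in V$; equivalently $d(w,V) = \|w\|$. For $T \in \mathcal{L}(X,Y)$, $T^{\ast\ast} \in \mathcal{L}(X^{\ast\ast},Y^{\ast\ast})$ is the biadjoint (second adjoint). $Z^{\bot} \subset Y^{\ast}$ is the annihilator of $Z$, and $Z^{\bot\bot} \subset Y^{\ast\ast}$ is the annihilator of $Z^{\bot}$ in $Y^{\ast\ast}$ (canonically identified with $Z^{\ast\ast}$). *)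

theory Defs
  imports "HOL-Analysis.Analysis"
begin

definition canonical_embedding ::
    "'a::real_normed_vector \<Rightarrow> (('a \<Rightarrow>\<^sub>L real) \<Rightarrow>\<^sub>L real)" where
  "canonical_embedding x = Blinfun (\<lambda>f. blinfun_apply f x)"

lemma canonical_embedding_apply [simp]:
  "blinfun_apply (canonical_embedding x) f = blinfun_apply f x"
  unfolding canonical_embedding_def
  by (subst bounded_linear_Blinfun_apply) (auto intro: bounded_linear_intros)

definition reflexive_space :: "'a::real_normed_vector itself \<Rightarrow> bool" where
  "reflexive_space _ \<longleftrightarrow>
     surj (canonical_embedding :: 'a \<Rightarrow> (('a \<Rightarrow>\<^sub>L real) \<Rightarrow>\<^sub>L real))"

definition dual_adjoint ::
    "('a::real_normed_vector \<Rightarrow>\<^sub>L 'b::real_normed_vector) \<Rightarrow>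
     (('b \<Rightarrow>\<^sub>L real) \<Rightarrow>\<^sub>L ('a \<Rightarrow>\<^sub>L real))" where
  "dual_adjoint T = Blinfun (\<lambda>f. f o\<^sub>L T)"

lemma dual_adjoint_apply [simp]:
  "blinfun_apply (dual_adjoint T) f = f o\<^sub>L T"
  unfolding dual_adjoint_def
  by (subst bounded_linear_Blinfun_apply)
    (auto intro: bounded_bilinear.bounded_linear_left[OF bounded_bilinear_blinfun_compose])

definition biadjoint ::
    "('a::real_normed_vector \<Rightarrow>\<^sub>L 'b::real_normed_vector) \<Rightarrow>
     ((('a \<Rightarrow>\<^sub>L real) \<Rightarrow>\<^sub>L real) \<Rightarrow>\<^sub>L (('b \<Rightarrow>\<^sub>L real) \<Rightarrow>\<^sub>L real))" where
  "biadjoint T = dual_adjoint (dual_adjoint T)"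

definition annihilator :: "'a::real_normed_vector set \<Rightarrow> ('a \<Rightarrow>\<^sub>L real) set" where
  "annihilator S = {f. \<forall>x\<in>S. blinfun_apply f x = 0}"

definition bj_orthogonal :: "'a::real_normed_vector \<Rightarrow> 'a set \<Rightarrow> bool" where
  "bj_orthogonal w V \<longleftrightarrow> (\<forall>v\<in>V. norm (w + v) \<ge> norm w)"

definition operators_into ::
    "'b set \<Rightarrow> ('a::real_normed_vector \<Rightarrow>\<^sub>L 'b::real_normed_vector) set" where
  "operators_into Z = {S. range (blinfun_apply S) \<subseteq> Z}"

(* The cosets of finitely many vectors span the quotient by Z. *)
definition finite_codimension :: "'a::real_vector set \<Rightarrow> bool" where
  "finite_codimension Z \<longleftrightarrow> (\<exists>B. finite B \<and> (\<forall>y. \<exists>b\<in>span B. y - b \<in> Z))"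

definition contractive_projection :: "('a::real_normed_vector \<Rightarrow>\<^sub>L 'a) \<Rightarrow> bool" where
  "contractive_projection P \<longleftrightarrow> P o\<^sub>L P = P \<and> norm P \<le> 1"

end

theory Submission
  imports Defs
begin

text \<open>
  Write \<open>P\<close> for the contractive projection with kernel \<open>Z\<close>. Since \<open>T - P T\<close> takes values in \<open>Z\<close>,
  orthogonality gives \<open>\<parallel>T\<parallel> \<le> \<parallel>P T\<parallel>\<close>, and contractivity gives the converse. The advantage of
  \<open>P T\<close> is that its range lies in the range of \<open>P\<close>, which is finite-dimensional because \<open>Z\<close>
  has finite codimension. By compactness the images under \<open>P T\<close> of suitable vectors of the unit ball
  of \<open>X\<close> converge to a vector \<open>y\<close> of norm \<open>\<parallel>T\<parallel>\<close>, and a functional \<open>f\<close> of norm at most \<open>1\<close> with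
  \<open>f y = \<parallel>y\<parallel>\<close> then satisfies \<open>\<parallel>f \<circ> P \<circ> T\<parallel> = \<parallel>T\<parallel>\<close> (\<open>finite_rank_norming_functional\<close>).

  The functional \<open>\<psi> = f \<circ> P \<circ> T\<close> attains its norm, as a vector of the dual of \<open>X\<close>, at an extreme
  point \<open>\<Lambda>\<close> of the unit ball of the bidual (\<open>extreme_norming_functional\<close>). For every \<open>W\<close> in the
  double annihilator of \<open>Z\<close> one has \<open>W (f \<circ> P) = 0\<close>, because \<open>f \<circ> P\<close> vanishes on \<open>Z\<close>. Hence
  \<open>\<parallel>T\<^sup>*\<^sup>* \<Lambda> + W\<parallel> \<ge> (T\<^sup>*\<^sup>* \<Lambda> + W) (f \<circ> P) = \<Lambda> \<psi> = \<parallel>T\<parallel>\<close>, which for \<open>W = 0\<close> shows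
  that \<open>T\<^sup>*\<^sup>*\<close> attains its norm at \<open>\<Lambda>\<close> and for general \<open>W\<close> shows the orthogonality.

  The extreme point is found without using a weak-star topology. A nonempty weak-star compact convex
  set of functionals is encoded by its support function, a sublinear functional \<open>q\<close>; its members
  are the linear functionals below \<open>q\<close>. Zorn's lemma gives a minimal \<open>q\<close> among the support
  functions of faces of the ball. The minorants of \<open>q\<close> that attain \<open>q x\<close> at a given \<open>x\<close> form
  again a face, so minimality forces \<open>q\<close> to be linear: the face is a single extreme point.
  This also contains the Hahn-Banach theorem that provides \<open>f\<close>.
\<close>

section \<open>Sublinear functionals and faces\<close>

definition sublinear :: "('a::real_vector \<Rightarrow> real) \<Rightarrow> bool" where
  "sublinear q \<longleftrightarrow> (\<forall>x y. q (x + y) \<le> q x + q y) \<and> (\<forall>c x. c \<ge> 0 \<longrightarrow> q (c *\<^sub>R x) = c * q x)"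

lemma sublinear_add: "sublinear q \<Longrightarrow> q (x + y) \<le> q x + q y"
  by (simp add: sublinear_def)

lemma sublinear_scale: "sublinear q \<Longrightarrow> c \<ge> 0 \<Longrightarrow> q (c *\<^sub>R x) = c * q x"
  by (simp add: sublinear_def)

lemma sublinear_zero: "sublinear q \<Longrightarrow> q 0 = 0"
  using sublinear_scale[of q 0 0] by simp

lemma sublinear_minus: "sublinear q \<Longrightarrow> - q (- x) \<le> q x"
  using sublinear_add[of q x "- x"] sublinear_zero[of q] by simp

lemma sublinear_norm: "sublinear (norm :: 'a::real_normed_vector \<Rightarrow> real)"
  by (simp add: sublinear_def norm_triangle_ineq)

lemma sublinear_odd_imp_linear:
  assumes q: "sublinear q" and odd: "\<And>x. q (- x) \<le> - q x"
  shows "linear q"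
proof -
  have minus: "q (- x) = - q x" for x
    using odd[of x] sublinear_minus[OF q, of x] by simp
  have add: "q (x + y) = q x + q y" for x y
    using sublinear_add[OF q, of x y] sublinear_add[OF q, of "- x" "- y"] minus[of "x + y"]
    by (simp add: minus)
  have "q (c *\<^sub>R x) = c * q x" for c x
  proof (cases "c \<ge> 0")
    case False
    then have "q ((- c) *\<^sub>R x) = (- c) * q x"
      by (intro sublinear_scale[OF q]) simp
    then show ?thesis using minus[of "c *\<^sub>R x"] by simp
  qed (simp add: sublinear_scale[OF q])
  with add show ?thesis by (intro linearI) auto
qed

text \<open>
  The convex set of all linear functionals below \<open>q\<close> is a face of the set of those below \<open>p\<close>.
  Exchanging \<open>a\<close> with \<open>b\<close> and \<open>u\<close> with \<open>1 - u\<close> shows that the condition bounds both end points.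
\<close>

definition face_of_minorants :: "('a::real_vector \<Rightarrow> real) \<Rightarrow> ('a \<Rightarrow> real) \<Rightarrow> bool" where
  "face_of_minorants p q \<longleftrightarrow> sublinear q \<and> q \<le> p \<and>
     (\<forall>a b u. linear a \<longrightarrow> linear b \<longrightarrow> a \<le> p \<longrightarrow> b \<le> p \<longrightarrow> 0 < u \<longrightarrow> u < 1 \<longrightarrow>
        (\<lambda>x. (1 - u) * a x + u * b x) \<le> q \<longrightarrow> a \<le> q)"

lemma face_of_minorantsD:
  assumes "face_of_minorants p q" "linear a" "linear b" "a \<le> p" "b \<le> p" "0 < u" "u < 1"
    "(\<lambda>x. (1 - u) * a x + u * b x) \<le> q"
  shows "a \<le> q" "b \<le> q"
proof -
  show "a \<le> q" using assms unfolding face_of_minorants_def by blast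
  have "(\<lambda>x. (1 - (1 - u)) * b x + (1 - u) * a x) \<le> q"
    using assms(8) by (simp add: add.commute)
  moreover have "0 < 1 - u" "1 - u < 1" using assms by auto
  ultimately show "b \<le> q" using assms(1-5) unfolding face_of_minorants_def by blast
qed

text \<open>
  The support function of the exposed face on which the evaluation at \<open>x\<close> is maximal: a linear
  \<open>a \<le> q\<close> with \<open>a x = q x\<close> satisfies \<open>a y = a (y + t x) - t a x \<le> q (y + t x) - t q x\<close> for
  all \<open>t \<ge> 0\<close>.
\<close>

definition exposed_support :: "('a::real_vector \<Rightarrow> real) \<Rightarrow> 'a \<Rightarrow> 'a \<Rightarrow> real" where
  "exposed_support q x y = (INF t\<in>{0..}. q (y + t *\<^sub>R x) - t * q x)"

lemma exposed_support_le:
  assumes q: "sublinear q" and "t \<ge> 0"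
  shows "exposed_support q x y \<le> q (y + t *\<^sub>R x) - t * q x"
  unfolding exposed_support_def
proof (rule cINF_lower)
  have "- q (- y) \<le> q (y + s *\<^sub>R x) - s * q x" if "s \<ge> 0" for s
    using sublinear_add[OF q, of "y + s *\<^sub>R x" "- y"] sublinear_scale[OF q that, of x] by simp
  then show "bdd_below ((\<lambda>t. q (y + t *\<^sub>R x) - t * q x) ` {0..})"
    by (intro bdd_belowI2) auto
qed (use assms in auto)

lemma exposed_support_greatest:
  "(\<And>t. t \<ge> 0 \<Longrightarrow> c \<le> q (y + t *\<^sub>R x) - t * q x) \<Longrightarrow> c \<le> exposed_support q x y"
  unfolding exposed_support_def by (rule cINF_greatest) auto

lemma exposed_support_le_self: "sublinear q \<Longrightarrow> exposed_support q x \<le> q"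
  using exposed_support_le[of q 0 x] by (auto simp: le_fun_def)

lemma exposed_support_minus: "sublinear q \<Longrightarrow> exposed_support q x (- x) \<le> - q x"
  using exposed_support_le[of q 1 x "- x"] by (simp add: sublinear_zero)

lemma sublinear_exposed_support:
  assumes q: "sublinear q"
  shows "sublinear (exposed_support q x)"
proof -
  let ?e = "exposed_support q x"
  have add: "?e (y + z) \<le> ?e y + ?e z" for y z
  proof -
    have *: "?e (y + z) \<le> (q (y + s *\<^sub>R x) - s * q x) + (q (z + t *\<^sub>R x) - t * q x)"
      if "s \<ge> 0" "t \<ge> 0" for s t
    proof -
      have "?e (y + z) \<le> q ((y + z) + (s + t) *\<^sub>R x) - (s + t) * q x"
        by (rule exposed_support_le) (use q that in auto)
      also have "(y + z) + (s + t) *\<^sub>R x = (y + s *\<^sub>R x) + (z + t *\<^sub>R x)"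
        by (simp add: algebra_simps)
      also have "q \<dots> \<le> q (y + s *\<^sub>R x) + q (z + t *\<^sub>R x)" by (rule sublinear_add[OF q])
      finally show ?thesis by (simp add: algebra_simps)
    qed
    have "?e (y + z) - (q (y + s *\<^sub>R x) - s * q x) \<le> ?e z" if "s \<ge> 0" for s
      by (rule exposed_support_greatest) (use *[OF that] in \<open>simp add: algebra_simps\<close>)
    then have "?e (y + z) - ?e z \<le> ?e y"
      by (intro exposed_support_greatest) (simp add: algebra_simps)
    then show ?thesis by simp
  qed
  have scale_le: "?e (c *\<^sub>R y) \<le> c * ?e y" if "c > 0" for c y
  proof -
    have "?e (c *\<^sub>R y) / c \<le> q (y + t *\<^sub>R x) - t * q x" if "t \<ge> 0" for t
    proof -
      have "?e (c *\<^sub>R y) \<le> q (c *\<^sub>R y + (c * t) *\<^sub>R x) - (c * t) * q x"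
        by (rule exposed_support_le) (use q \<open>c > 0\<close> that in auto)
      also have "c *\<^sub>R y + (c * t) *\<^sub>R x = c *\<^sub>R (y + t *\<^sub>R x)" by (simp add: algebra_simps)
      also have "q \<dots> = c * q (y + t *\<^sub>R x)" using \<open>c > 0\<close> by (simp add: sublinear_scale[OF q])
      finally show ?thesis using \<open>c > 0\<close> by (simp add: field_simps)
    qed
    then have "?e (c *\<^sub>R y) / c \<le> ?e y" by (rule exposed_support_greatest)
    then show ?thesis using that by (simp add: field_simps)
  qed
  have "?e (c *\<^sub>R y) = c * ?e y" if "c \<ge> 0" for c y
  proof (cases "c = 0")
    case True
    have "?e 0 \<le> 0" using exposed_support_le_self[OF q, of x] sublinear_zero[OF q]
      by (auto simp: le_fun_def dest: spec[of _ 0])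
    moreover have "0 \<le> ?e 0"
      by (rule exposed_support_greatest) (simp add: sublinear_scale[OF q])
    ultimately show ?thesis using True by simp
  next
    case False
    with that have "c > 0" by simp
    \<comment> \<open>The reverse inequality is the same one for the factor \<open>1 / c\<close> and the vector \<open>c y\<close>.\<close>
    from scale_le[of "1 / c" "c *\<^sub>R y"] \<open>c > 0\<close> have "c * ?e y \<le> ?e (c *\<^sub>R y)"
      by (simp add: field_simps)
    with scale_le[OF \<open>c > 0\<close>, of y] show ?thesis by simp
  qed
  with add show ?thesis by (simp add: sublinear_def)
qed

text \<open>
  A convex combination of \<open>a\<close> and \<open>b\<close> can reach the maximal value \<open>q x\<close> at \<open>x\<close> only if both
  \<open>a\<close> and \<open>b\<close> do.
\<close>

lemma face_of_minorants_exposed_support: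
  assumes face: "face_of_minorants p q"
  shows "face_of_minorants p (exposed_support q x)"
proof -
  let ?e = "exposed_support q x"
  have q: "sublinear q" and "q \<le> p" using face by (auto simp: face_of_minorants_def)
  have e_le: "?e \<le> q" by (rule exposed_support_le_self[OF q])
  have "a \<le> ?e"
    if ab: "linear a" "linear b" "a \<le> p" "b \<le> p" and u: "0 < u" "u < 1"
      and le: "(\<lambda>y. (1 - u) * a y + u * b y) \<le> ?e" for a b u
  proof -
    have aq: "a \<le> q" and bq: "b \<le> q"
      using face_of_minorantsD[OF face ab u order_trans[OF le e_le]] by auto
    have "(1 - u) * a (- x) + u * b (- x) \<le> - q x"
      using le_funD[OF le, of "- x"] exposed_support_minus[OF q, of x] by simp
    then have "q x \<le> (1 - u) * a x + u * b x"
      using ab by (simp add: linear_neg)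
    also have "\<dots> \<le> (1 - u) * a x + u * q x"
      using u le_funD[OF bq, of x] by (simp add: mult_left_mono)
    finally have "(1 - u) * q x \<le> (1 - u) * a x" by (simp add: algebra_simps)
    then have "q x \<le> a x" using u by simp
    then have ax: "a x = q x" using le_funD[OF aq, of x] by simp
    have "a y \<le> ?e y" for y
    proof (rule exposed_support_greatest)
      fix t :: real
      show "a y \<le> q (y + t *\<^sub>R x) - t * q x"
        using le_funD[OF aq, of "y + t *\<^sub>R x"] ab(1) ax
        by (simp add: linear_add linear_cmul)
    qed
    then show ?thesis by (simp add: le_fun_def)
  qed
  then show ?thesis
    using sublinear_exposed_support[OF q] order_trans[OF e_le \<open>q \<le> p\<close>]
    unfolding face_of_minorants_def by blast
qed

text \<open>
  This replaces the weak-star compactness that makes the intersection of a chain of faces nonempty.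
  All members of the chain are bounded below by \<open>\<lambda>x. - p (- x)\<close>.
\<close>

lemma face_of_minorants_chain_INF:
  assumes C: "C \<noteq> {}" and face: "\<And>q. q \<in> C \<Longrightarrow> face_of_minorants p q"
    and chain: "\<And>q r. q \<in> C \<Longrightarrow> r \<in> C \<Longrightarrow> q \<le> r \<or> r \<le> q"
  defines "m \<equiv> \<lambda>x. INF q\<in>C. q x"
  shows "face_of_minorants p m" and "\<And>q. q \<in> C \<Longrightarrow> m \<le> q"
proof -
  have sub: "sublinear q" and le_p: "q \<le> p" if "q \<in> C" for q
    using face[OF that] by (auto simp: face_of_minorants_def)
  have "- p (- x) \<le> q x" if "q \<in> C" for q x
    using sublinear_minus[OF sub[OF that], of x] le_funD[OF le_p[OF that], of "- x"] by simp
  then have bdd: "bdd_below ((\<lambda>q. q x) ` C)" for x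
    by (intro bdd_belowI2) auto
  have lower: "m x \<le> q x" if "q \<in> C" for q x
    unfolding m_def by (rule cINF_lower[OF bdd that])
  then show m_le: "\<And>q. q \<in> C \<Longrightarrow> m \<le> q" by (auto simp: le_fun_def)
  have greatest: "c \<le> m x" if "\<And>q. q \<in> C \<Longrightarrow> c \<le> q x" for c x
    unfolding m_def by (rule cINF_greatest[OF C]) (use that in auto)
  have "m (x + y) \<le> m x + m y" for x y
  proof -
    have *: "m (x + y) \<le> q x + r y" if qr: "q \<in> C" "r \<in> C" for q r
    proof -
      \<comment> \<open>The smaller of \<open>q\<close> and \<open>r\<close> is used for both summands.\<close>
      obtain s where s: "s \<in> C" "s \<le> q" "s \<le> r" using chain[OF qr] qr by blast
      have "m (x + y) \<le> s (x + y)" by (rule lower[OF s(1)])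
      also have "\<dots> \<le> s x + s y" by (rule sublinear_add[OF sub[OF s(1)]])
      also have "\<dots> \<le> q x + r y" using s by (simp add: le_fun_def add_mono)
      finally show ?thesis .
    qed
    have "m (x + y) - q x \<le> m y" if "q \<in> C" for q
      by (rule greatest) (use *[OF that] in \<open>simp add: algebra_simps\<close>)
    then have "m (x + y) - m y \<le> m x"
      by (intro greatest) (simp add: algebra_simps)
    then show ?thesis by simp
  qed
  moreover have "m (c *\<^sub>R x) = c * m x" if "c \<ge> 0" for c x
  proof (cases "c = 0")
    case True
    obtain q where "q \<in> C" using C by blast
    then have "m 0 \<le> 0" using lower[of q 0] sublinear_zero[OF sub[of q]] by simp
    moreover have "0 \<le> m 0" by (rule greatest) (simp add: sublinear_zero[OF sub])
    ultimately show ?thesis using True by simp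
  next
    case False
    with that have "c > 0" by simp
    have "m (c *\<^sub>R x) / c \<le> m x"
    proof (rule greatest)
      fix q assume "q \<in> C"
      then show "m (c *\<^sub>R x) / c \<le> q x"
        using lower[of q "c *\<^sub>R x"] sublinear_scale[OF sub[of q]] \<open>c > 0\<close>
        by (simp add: field_simps)
    qed
    moreover have "c * m x \<le> m (c *\<^sub>R x)"
    proof (rule greatest)
      fix q assume "q \<in> C"
      then show "c * m x \<le> q (c *\<^sub>R x)"
        using lower[of q x] sublinear_scale[OF sub[of q]] \<open>c > 0\<close> by simp
    qed
    ultimately show ?thesis using \<open>c > 0\<close> by (simp add: field_simps)
  qed
  ultimately have "sublinear m" by (simp add: sublinear_def)
  moreover have "m \<le> p" using C m_le le_p order_trans by blast
  moreover have "a \<le> m"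
    if "linear a" "linear b" "a \<le> p" "b \<le> p" "0 < u" "u < 1"
      and le: "(\<lambda>x. (1 - u) * a x + u * b x) \<le> m" for a b u
  proof -
    have "a \<le> q" if "q \<in> C" for q
      by (rule face_of_minorantsD(1)[OF face[OF that] \<open>linear a\<close> \<open>linear b\<close> \<open>a \<le> p\<close> \<open>b \<le> p\<close>
            \<open>0 < u\<close> \<open>u < 1\<close> order_trans[OF le m_le[OF that]]])
    then show ?thesis by (auto simp: le_fun_def intro!: greatest)
  qed
  ultimately show "face_of_minorants p m" unfolding face_of_minorants_def by blast
qed

text \<open>
  This is the Krein-Milman step: a minimal face is not changed by passing to the exposed face at
  any \<open>x\<close>, hence its support function \<open>q\<close> satisfies \<open>q (- x) \<le> - q x\<close> for all \<open>x\<close>.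
\<close>

lemma face_of_minorants_contains_linear:
  assumes q0: "face_of_minorants p q0"
  obtains l where "linear l" "face_of_minorants p l" "l \<le> q0"
proof -
  define A where "A = {q. face_of_minorants p q \<and> q \<le> q0}"
  have "\<exists>m\<in>A. \<forall>q\<in>A. m \<ge> q \<longrightarrow> q = m"
  proof (rule predicate_Zorn)
    show "partial_order_on A (relation_of (\<ge>) A)"
      by (rule partial_order_on_relation_ofI) auto
    fix C assume C: "C \<in> Chains (relation_of (\<ge>) A)"
    then have CA: "C \<subseteq> A" and chain: "\<And>q r. q \<in> C \<Longrightarrow> r \<in> C \<Longrightarrow> q \<le> r \<or> r \<le> q"
      by (auto simp: Chains_def relation_of_def)
    show "\<exists>m\<in>A. \<forall>q\<in>C. q \<ge> m"
    proof (cases "C = {}")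
      case True
      then show ?thesis using q0 by (auto simp: A_def)
    next
      case False
      let ?m = "\<lambda>x. INF q\<in>C. q x"
      have face: "\<And>q. q \<in> C \<Longrightarrow> face_of_minorants p q" using CA by (auto simp: A_def)
      note INF = face_of_minorants_chain_INF[OF False face chain]
      obtain q where "q \<in> C" using False by blast
      then have "?m \<le> q0" using INF(2)[of q] CA by (auto simp: A_def)
      then have "?m \<in> A" using INF(1) by (simp add: A_def)
      then show ?thesis using INF(2) by blast
    qed
  qed
  then obtain m where "m \<in> A" and min: "\<And>q. q \<in> A \<Longrightarrow> q \<le> m \<Longrightarrow> q = m" by blast
  then have face: "face_of_minorants p m" and "m \<le> q0" by (auto simp: A_def)
  then have m: "sublinear m" by (simp add: face_of_minorants_def)
  have "exposed_support m x = m" for x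
  proof (rule min)
    show "exposed_support m x \<le> m" by (rule exposed_support_le_self[OF m])
    then show "exposed_support m x \<in> A"
      using face_of_minorants_exposed_support[OF face] \<open>m \<le> q0\<close> by (auto simp: A_def)
  qed
  then have "m (- x) \<le> - m x" for x
    using exposed_support_minus[OF m, of x] by simp
  then have "linear m" by (rule sublinear_odd_imp_linear[OF m])
  then show ?thesis using that face \<open>m \<le> q0\<close> by blast
qed

section \<open>Extreme norming functionals\<close>

lemma norm_blinfun_le_one_iff:
  fixes f :: "'a::real_normed_vector \<Rightarrow>\<^sub>L real"
  shows "norm f \<le> 1 \<longleftrightarrow> blinfun_apply f \<le> norm"
proof
  assume "norm f \<le> 1"
  then show "blinfun_apply f \<le> norm"
    using order_trans[OF norm_blinfun[of f] mult_right_mono[of "norm f" 1]]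
    by (intro le_funI) (auto intro: order_trans[OF abs_ge_self])
next
  assume le: "blinfun_apply f \<le> norm"
  have "norm (blinfun_apply f x) \<le> 1 * norm x" for x
    using le_funD[OF le, of x] le_funD[OF le, of "- x"] by (simp add: blinfun.minus_right)
  then show "norm f \<le> 1" by (intro norm_blinfun_bound) auto
qed

text \<open>
  The minorants of the norm are exactly the functionals in the dual unit ball, and a face with a
  linear support function consists of that functional alone.
\<close>

theorem extreme_norming_functional:
  fixes x :: "'a::real_normed_vector"
  obtains \<Lambda> :: "'a \<Rightarrow>\<^sub>L real"
  where "\<Lambda> extreme_point_of cball 0 1" "blinfun_apply \<Lambda> x = norm x"
proof -
  let ?p = "norm :: 'a \<Rightarrow> real"
  have "face_of_minorants ?p ?p"
    by (auto simp: face_of_minorants_def sublinear_norm)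
  then have "face_of_minorants ?p (exposed_support ?p x)"
    by (rule face_of_minorants_exposed_support)
  then obtain l where l: "linear l" "face_of_minorants ?p l" "l \<le> exposed_support ?p x"
    by (rule face_of_minorants_contains_linear)
  have le: "l \<le> ?p" using l(2) by (simp add: face_of_minorants_def)
  have "\<bar>l y\<bar> \<le> norm y * 1" for y
    using le_funD[OF le, of y] le_funD[OF le, of "- y"] l(1) by (simp add: linear_neg)
  then have "bounded_linear l"
    using l(1) by (intro bounded_linear_intro[where K = 1]) (auto simp: linear_add linear_cmul)
  then have L: "blinfun_apply (Blinfun l) = l" by (rule bounded_linear_Blinfun_apply)
  have "l (- x) \<le> - norm x"
    using le_funD[OF l(3), of "- x"] exposed_support_minus[OF sublinear_norm, of x] by simp
  then have lx: "l x = norm x" using le_funD[OF le, of x] l(1) by (simp add: linear_neg)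
  have "Blinfun l extreme_point_of cball 0 1"
    unfolding extreme_point_of_def
  proof (intro conjI ballI notI)
    show "Blinfun l \<in> cball 0 1" using le by (simp add: norm_blinfun_le_one_iff L)
    fix a b :: "'a \<Rightarrow>\<^sub>L real"
    assume ab: "a \<in> cball 0 1" "b \<in> cball 0 1" and seg: "Blinfun l \<in> open_segment a b"
    then obtain u where u: "0 < u" "u < 1" "a \<noteq> b"
      and eq: "Blinfun l = (1 - u) *\<^sub>R a + u *\<^sub>R b"
      by (auto simp: in_segment)
    have "l = (\<lambda>y. (1 - u) * blinfun_apply a y + u * blinfun_apply b y)"
      using arg_cong[OF eq, of blinfun_apply] L
      by (simp add: fun_eq_iff blinfun.add_left blinfun.scaleR_left)
    then have "blinfun_apply a \<le> l" "blinfun_apply b \<le> l"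
      using face_of_minorantsD[OF l(2), of a b u] ab u
      by (auto simp: norm_blinfun_le_one_iff bounded_linear.linear[OF blinfun.bounded_linear_right])
    \<comment> \<open>A linear functional below another one is equal to it, by evaluation at \<open>- y\<close>.\<close>
    moreover have "c = Blinfun l" if c: "blinfun_apply c \<le> l" for c
    proof (rule blinfun_eqI)
      fix y
      show "blinfun_apply c y = blinfun_apply (Blinfun l) y"
        using le_funD[OF c, of y] le_funD[OF c, of "- y"] l(1)
        by (simp add: L linear_neg blinfun.minus_right)
    qed
    ultimately show False using u(3) by metis
  qed
  then show ?thesis using that lx L by simp
qed

section \<open>Operators of finite rank\<close>

text \<open>
  A vector \<open>b\<close> outside the closed subspace \<open>span B\<close> has positive distance \<open>d\<close> from it, so the
  coefficient \<open>t\<close> of \<open>b\<close> in a vector of norm at most \<open>r\<close> satisfies \<open>\<bar>t\<bar> \<le> r / d\<close>. Bounded parts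
  of the larger span are therefore covered by images of compact products.
\<close>

lemma compact_cball_Int_span:
  fixes B :: "'a::real_normed_vector set"
  assumes "finite B"
  shows "compact (cball 0 r \<inter> span B)"
  using assms
proof (induction B arbitrary: r rule: finite_induct)
  case empty
  then show ?case by (simp add: Int_insert_right)
next
  case (insert b B)
  have "closed (span B)"
    unfolding closed_sequential_limits
  proof (intro allI impI, elim conjE)
    fix s l assume s: "\<forall>n. s n \<in> span B" "s \<longlonglongrightarrow> l"
    then have "bounded (range s)" using convergent_imp_bounded by blast
    then obtain R where "\<forall>n. s n \<in> cball 0 R" by (auto simp: bounded_iff)
    with s(1) have "\<forall>n. s n \<in> cball 0 R \<inter> span B" by blast
    then have "l \<in> cball 0 R \<inter> span B"
      using closed_sequentially[OF compact_imp_closed[OF insert.IH]] s(2) by blast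
    then show "l \<in> span B" by blast
  qed
  show ?case
  proof (cases "b \<in> span B")
    case True
    then show ?thesis using insert.IH by (simp add: span_redundant)
  next
    case False
    define d where "d = infdist b (span B)"
    have "span B \<noteq> {}" using span_0 by blast
    then have "d \<noteq> 0"
      using False in_closed_iff_infdist_zero[OF \<open>closed (span B)\<close>] by (simp add: d_def)
    then have "d > 0" using infdist_nonneg[of b "span B"] by (simp add: d_def)
    define K where "K = (\<lambda>(t, v). t *\<^sub>R b + v) `
      ({- (r / d)..r / d} \<times> (cball 0 (r + r / d * norm b) \<inter> span B))"
    have "compact K"
      unfolding K_def
      by (intro compact_continuous_image compact_Times insert.IH compact_Icc)
        (auto simp: case_prod_unfold intro!: continuous_intros)
    have "cball 0 r \<inter> span (insert b B) = cball 0 r \<inter> K"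
    proof (intro equalityI subsetI)
      fix x assume x: "x \<in> cball 0 r \<inter> span (insert b B)"
      then obtain t where v: "x - t *\<^sub>R b \<in> span B" by (auto simp: span_insert)
      have t: "\<bar>t\<bar> * d \<le> r"
      proof (cases "t = 0")
        case True
        have "0 \<le> norm x" by simp
        also have "\<dots> \<le> r" using x by simp
        finally show ?thesis using True by simp
      next
        case False
        \<comment> \<open>\<open>x = t (b - w)\<close> for a vector \<open>w\<close> of \<open>span B\<close>.\<close>
        define w where "w = (- 1 / t) *\<^sub>R (x - t *\<^sub>R b)"
        have "w \<in> span B" unfolding w_def by (rule span_scale[OF v])
        then have "d \<le> norm (b - w)" unfolding d_def using infdist_le[of w "span B" b]
          by (simp add: dist_norm)
        then have "\<bar>t\<bar> * d \<le> norm (t *\<^sub>R (b - w))" by (simp add: mult_left_mono)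
        also have "t *\<^sub>R (b - w) = x" using False by (simp add: w_def algebra_simps)
        finally show ?thesis using x by simp
      qed
      then have t': "\<bar>t\<bar> \<le> r / d" using \<open>d > 0\<close> by (simp add: field_simps)
      have "norm (x - t *\<^sub>R b) \<le> norm x + \<bar>t\<bar> * norm b"
        using norm_triangle_ineq4[of x "t *\<^sub>R b"] by simp
      also have "\<dots> \<le> r + r / d * norm b" using x t' by (intro add_mono mult_right_mono) auto
      finally have "x \<in> K" unfolding K_def
        using v t' by (intro image_eqI[of _ _ "(t, x - t *\<^sub>R b)"]) auto
      then show "x \<in> cball 0 r \<inter> K" using x by blast
    next
      fix x assume x: "x \<in> cball 0 r \<inter> K"
      then obtain t v where "x = t *\<^sub>R b + v" "v \<in> span B" by (auto simp: K_def)
      then have "x - t *\<^sub>R b \<in> span B" by simp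
      then show "x \<in> cball 0 r \<inter> span (insert b B)"
        using x by (auto simp: span_insert)
    qed
    then show ?thesis using \<open>compact K\<close> by (simp add: closed_Int_compact)
  qed
qed

text \<open>
  A maximising sequence in the unit ball has images in a compact set. Any norming functional of a
  limit point of these images attains the supremum.
\<close>

lemma finite_rank_norming_functional:
  fixes S :: "'a::real_normed_vector \<Rightarrow>\<^sub>L 'b::real_normed_vector"
  assumes "finite B" and range: "range (blinfun_apply S) \<subseteq> span B"
  obtains f :: "'b \<Rightarrow>\<^sub>L real" where "norm f \<le> 1" "norm (f o\<^sub>L S) = norm S"
proof -
  have "\<exists>x. norm x \<le> 1 \<and> norm S - 1 / Suc n \<le> norm (blinfun_apply S x)" for n
  proof (rule ccontr)
    assume "\<not> ?thesis"
    then have less: "norm (blinfun_apply S x) < norm S - 1 / Suc n" if "norm x \<le> 1" for x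
      using that not_le by blast
    have "norm (blinfun_apply S x) \<le> (norm S - 1 / Suc n) * norm x" for x
    proof (cases "x = 0")
      case False
      then have "norm (blinfun_apply S (x /\<^sub>R norm x)) \<le> norm S - 1 / Suc n"
        by (intro less_imp_le[OF less]) simp
      then have "norm (blinfun_apply S x) / norm x \<le> norm S - 1 / Suc n"
        by (simp add: blinfun.scaleR_right divide_inverse mult.commute)
      moreover have "norm x > 0" using False by simp
      ultimately show ?thesis by (simp only: pos_divide_le_eq)
    qed simp
    then have "norm S \<le> norm S - 1 / Suc n"
      using less[of 0] by (intro norm_blinfun_bound) auto
    then show False by simp
  qed
  then obtain x where x: "\<And>n. norm (x n) \<le> 1"
    and Sx: "\<And>n. norm S - 1 / Suc n \<le> norm (blinfun_apply S (x n))" by metis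
  have Sx_le: "norm (blinfun_apply S (x n)) \<le> norm S" for n
    using norm_blinfun[of S "x n"] mult_left_le[OF x[of n], of "norm S"] by simp
  then have "\<forall>n. blinfun_apply S (x n) \<in> cball 0 (norm S) \<inter> span B" using range by auto
  then obtain y r where r: "strict_mono r"
    and lim: "((\<lambda>n. blinfun_apply S (x n)) \<circ> r) \<longlonglongrightarrow> y"
    by (rule seq_compactE[OF compact_imp_seq_compact[OF compact_cball_Int_span[OF assms(1)]]])
  have "(\<lambda>n. norm (blinfun_apply S (x n))) \<longlonglongrightarrow> norm S"
  proof (rule tendsto_sandwich)
    show "(\<lambda>n. norm S - 1 / Suc n) \<longlonglongrightarrow> norm S"
      using tendsto_diff[OF tendsto_const LIMSEQ_inverse_real_of_nat, of "norm S"]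
      by (simp add: inverse_eq_divide)
  qed (use Sx Sx_le in auto)
  from LIMSEQ_subseq_LIMSEQ[OF this r] tendsto_norm[OF lim] have y: "norm y = norm S"
    by (auto simp: o_def intro: LIMSEQ_unique)
  obtain f :: "'b \<Rightarrow>\<^sub>L real" where "f extreme_point_of cball 0 1" and fy: "blinfun_apply f y = norm y"
    by (rule extreme_norming_functional)
  then have f: "norm f \<le> 1" by (simp add: extreme_point_of_def)
  have "blinfun_apply f (blinfun_apply S (x n)) \<le> norm (f o\<^sub>L S)" for n
    using norm_blinfun[of "f o\<^sub>L S" "x n"] mult_left_le[OF x[of n], of "norm (f o\<^sub>L S)"] by simp
  moreover have "(\<lambda>n. blinfun_apply f (blinfun_apply S (x (r n)))) \<longlonglongrightarrow> norm S"
    using blinfun.tendsto[OF tendsto_const lim, of f] fy y by (simp add: o_def)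
  ultimately have "norm S \<le> norm (f o\<^sub>L S)" by (intro LIMSEQ_le_const2) auto
  moreover have "norm (f o\<^sub>L S) \<le> norm S"
    using norm_blinfun_compose[of f S] mult_right_mono[OF f, of "norm S"] by simp
  ultimately show ?thesis using that f by simp
qed

lemma range_subset_span_of_finite_codimension_kernel:
  assumes "finite_codimension {y. blinfun_apply P y = 0}"
  obtains B where "finite B" "range (blinfun_apply P) \<subseteq> span B"
proof -
  obtain B where B: "finite B" "\<And>y. \<exists>b\<in>span B. blinfun_apply P (y - b) = 0"
    using assms by (auto simp: finite_codimension_def)
  have "blinfun_apply P y \<in> span (blinfun_apply P ` B)" for y
  proof -
    obtain b where b: "b \<in> span B" "blinfun_apply P (y - b) = 0" using B(2) by blast
    then have "blinfun_apply P y = blinfun_apply P b" by (simp add: blinfun.diff_right)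
    moreover have "span (blinfun_apply P ` B) = blinfun_apply P ` span B"
      by (rule linear_span_image[OF bounded_linear.linear[OF blinfun.bounded_linear_right]])
    ultimately show ?thesis using b(1) by simp
  qed
  then show ?thesis using that[of "blinfun_apply P ` B"] B(1) by blast
qed

section \<open>Orthogonality at an extreme point of the bidual ball\<close>

lemma biadjoint_apply:
  "blinfun_apply (blinfun_apply (biadjoint T) \<Lambda>) f = blinfun_apply \<Lambda> (f o\<^sub>L T)"
  by (simp add: biadjoint_def)

lemma norm_dual_adjoint_le: "norm (dual_adjoint T) \<le> norm T"
proof (rule norm_blinfun_bound)
  show "norm (blinfun_apply (dual_adjoint T) f) \<le> norm T * norm f" for f
    using norm_blinfun_compose[of f T] by (simp add: mult.commute)
qed simp

lemma norm_biadjoint_le: "norm (biadjoint T) \<le> norm T"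
  unfolding biadjoint_def by (rule order_trans[OF norm_dual_adjoint_le norm_dual_adjoint_le])

theorem theorem6:
  fixes T :: "'x::banach \<Rightarrow>\<^sub>L 'y::banach"
    and Z :: "'y set"
  assumes "\<not> reflexive_space TYPE('y)"
    and "subspace Z"
    and "closed Z"
    and "finite_codimension Z"
    and "\<exists>P :: 'y \<Rightarrow>\<^sub>L 'y. contractive_projection P \<and> {y. blinfun_apply P y = 0} = Z"
    and "bj_orthogonal T (operators_into Z)"
  shows "\<exists>\<Lambda> :: ('x \<Rightarrow>\<^sub>L real) \<Rightarrow>\<^sub>L real.
           \<Lambda> extreme_point_of cball 0 1 \<and>
           norm T = norm (biadjoint T) \<and>
           norm (biadjoint T) = norm (blinfun_apply (biadjoint T) \<Lambda>) \<and>
           bj_orthogonal (blinfun_apply (biadjoint T) \<Lambda>) (annihilator (annihilator Z))"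
proof -
  obtain P :: "'y \<Rightarrow>\<^sub>L 'y" where PP: "P o\<^sub>L P = P" and P: "norm P \<le> 1"
    and ker: "{y. blinfun_apply P y = 0} = Z"
    using assms(5) by (auto simp: contractive_projection_def)
  have idem: "blinfun_apply P (blinfun_apply P y) = blinfun_apply P y" for y
    using arg_cong[OF PP, of "\<lambda>A. blinfun_apply A y"] by simp
  have "(P o\<^sub>L T) - T \<in> operators_into Z"
    using ker idem by (auto simp: operators_into_def blinfun.diff_left blinfun.diff_right)
  then have "norm T \<le> norm (T + ((P o\<^sub>L T) - T))"
    using assms(6) unfolding bj_orthogonal_def by blast
  also have "T + ((P o\<^sub>L T) - T) = P o\<^sub>L T" by simp
  finally have PT: "norm T \<le> norm (P o\<^sub>L T)" .
  have "finite_codimension {y. blinfun_apply P y = 0}" using assms(4) ker by simp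
  then obtain B where B: "finite B" "range (blinfun_apply P) \<subseteq> span B"
    by (rule range_subset_span_of_finite_codimension_kernel)
  then have "range (blinfun_apply (P o\<^sub>L T)) \<subseteq> span B" by auto
  then obtain f :: "'y \<Rightarrow>\<^sub>L real" where f: "norm f \<le> 1"
    and norm_f: "norm (f o\<^sub>L (P o\<^sub>L T)) = norm (P o\<^sub>L T)"
    by (rule finite_rank_norming_functional[OF B(1)])
  define g where "g = f o\<^sub>L P"
  have "norm g \<le> norm f * norm P" unfolding g_def by (rule norm_blinfun_compose)
  also have "\<dots> \<le> 1" using f P by (simp add: mult_le_one)
  finally have g: "norm g \<le> 1" .
  have gZ: "g \<in> annihilator Z" using ker by (auto simp: annihilator_def g_def)
  have "g o\<^sub>L T = f o\<^sub>L (P o\<^sub>L T)"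
    by (rule blinfun_eqI) (simp add: g_def)
  then have gT: "norm T \<le> norm (g o\<^sub>L T)"
    using PT norm_f by simp
  obtain \<Lambda> :: "('x \<Rightarrow>\<^sub>L real) \<Rightarrow>\<^sub>L real" where ext: "\<Lambda> extreme_point_of cball 0 1"
    and \<Lambda>: "blinfun_apply \<Lambda> (g o\<^sub>L T) = norm (g o\<^sub>L T)"
    by (rule extreme_norming_functional)
  let ?w = "blinfun_apply (biadjoint T) \<Lambda>"
  have lower: "norm T \<le> norm (?w + W)" if "W \<in> annihilator (annihilator Z)" for W
  proof -
    have "blinfun_apply W g = 0" using that gZ by (simp add: annihilator_def)
    then have "norm T \<le> blinfun_apply (?w + W) g"
      using \<Lambda> gT by (simp add: blinfun.add_left biadjoint_apply)
    also have "\<dots> \<le> norm (?w + W) * norm g"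
      using norm_blinfun[of "?w + W" g] by simp
    also have "\<dots> \<le> norm (?w + W)" using g by (simp add: mult_left_le)
    finally show ?thesis .
  qed
  have "norm \<Lambda> \<le> 1" using ext by (simp add: extreme_point_of_def)
  then have w_le: "norm ?w \<le> norm (biadjoint T)"
    using norm_blinfun[of "biadjoint T" \<Lambda>] mult_left_le[of "norm \<Lambda>" "norm (biadjoint T)"] by simp
  have "norm T \<le> norm ?w" using lower[of 0] by (simp add: annihilator_def)
  then have "norm T = norm (biadjoint T)" and "norm (biadjoint T) = norm ?w"
    using w_le norm_biadjoint_le[of T] by auto
  moreover from this have "bj_orthogonal ?w (annihilator (annihilator Z))"
    using lower by (simp add: bj_orthogonal_def)
  ultimately show ?thesis using ext by blast
qed

end
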